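(* If $\mathcal A$ is an arrangement of $n$ hyperplanes of rank $r$ in a finite-dimensional complex vector space $V$, then $$\mathrm{Hilb}(C_{\mathcal A,0};q)=q^{n-r}\,T_{\mathcal A}\!\left(1+q,\frac1q\right).$$
   Context: $\mathbb C[V^*]$ denotes the algebra of polynomial functions on $V$. A (central) arrangement $\mathcal A=\{H_1,\dots,H_n\}$ in $V$ is a finite list (repetitions allowed) of hyperplanes $H_i=\{l_i=0\}$ with $l_i\in V^*$; the degenerate case $l_i=0$ (a loop) is allowed. Its matroid is the linear matroid of $l_1,\dots,l_n$ with rank function $r(\cdot)$; the rank of $\mathcal A$ is $r=\dim\mathrm{span}(l_1,\dots,l_n)$. For nonzero $h\in V$, $\rho_{\mathcal A}(h)$ is the number of $i$ with $l_i(h)\neq 0$. $C_{\mathcal A,0}$ is the space of $f\in\mathbb C[V^*]$ such that for every nonzero $h\in V$ the restriction of $f$ to every affine line of direction $h$ has degree at most $\rho_{\mathcal A}(h)$; it is finite-dimensional and graded by degree, and $\mathrm{Hilb}(C;q)=\sum_i \dim C_i\,q^i$. The Tutte polynomial is $T_{\mathcal A}(x,y)=\sum_{S\subseteq[n]}(x-1)^{r-r(S)}(y-1)^{|S|-r(S)}$. *)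

theory Defs
  imports Complex_Main "HOL-Library.Function_Algebras"
    "HOL-Computational_Algebra.Formal_Laurent_Series"
begin

definition fun_scale :: "complex \<Rightarrow> ('v \<Rightarrow> complex) \<Rightarrow> 'v \<Rightarrow> complex" where
  "fun_scale c f = (\<lambda>x. c * f x)"

global_interpretation cfun: vector_space "fun_scale :: complex \<Rightarrow> ('v \<Rightarrow> complex) \<Rightarrow> 'v \<Rightarrow> complex"
  by unfold_locales (simp_all add: fun_scale_def fun_eq_iff algebra_simps)

text \<open>A finite-dimensional complex vector space \<open>V\<close> is a type with scalar multiplication
  \<open>scale\<close>; \<open>V = 0\<close> is included.\<close>

definition dual_space :: "(complex \<Rightarrow> 'v \<Rightarrow> 'v) \<Rightarrow> ('v::ab_group_add \<Rightarrow> complex) set" where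
  "dual_space scale = {l. Vector_Spaces.linear scale (*) l}"

inductive_set poly_functions :: "(complex \<Rightarrow> 'v \<Rightarrow> 'v) \<Rightarrow> ('v::ab_group_add \<Rightarrow> complex) set"
  for scale :: "complex \<Rightarrow> 'v::ab_group_add \<Rightarrow> 'v" where
  const: "(\<lambda>x. c) \<in> poly_functions scale"
| linear: "l \<in> dual_space scale \<Longrightarrow> l \<in> poly_functions scale"
| add: "f \<in> poly_functions scale \<Longrightarrow> g \<in> poly_functions scale \<Longrightarrow>
    (\<lambda>x. f x + g x) \<in> poly_functions scale"
| mult: "f \<in> poly_functions scale \<Longrightarrow> g \<in> poly_functions scale \<Longrightarrow>
    (\<lambda>x. f x * g x) \<in> poly_functions scale"

definition homogeneous_functions ::
    "(complex \<Rightarrow> 'v \<Rightarrow> 'v) \<Rightarrow> nat \<Rightarrow> ('v::ab_group_add \<Rightarrow> complex) set" where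
  "homogeneous_functions scale d =
     cfun.span {(\<lambda>x. \<Prod>l\<leftarrow>ls. l x) | ls. length ls = d \<and> set ls \<subseteq> dual_space scale}"

text \<open>An arrangement is the list of its defining linear forms (zero forms are loops);
  hyperplanes are indexed from 0.\<close>

definition matroid_rank :: "('v \<Rightarrow> complex) list \<Rightarrow> nat set \<Rightarrow> nat" where
  "matroid_rank A S = cfun.dim (cfun.span ((!) A ` S))"

definition arrangement_rank :: "('v \<Rightarrow> complex) list \<Rightarrow> nat" where
  "arrangement_rank A = cfun.dim (cfun.span (set A))"

definition tutte :: "('v \<Rightarrow> complex) list \<Rightarrow> 'a::comm_ring_1 \<Rightarrow> 'a \<Rightarrow> 'a" where
  "tutte A x y = (\<Sum>S\<in>Pow {..<length A}.
     (x - 1) ^ (arrangement_rank A - matroid_rank A S) * (y - 1) ^ (card S - matroid_rank A S))"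

definition rho :: "('v \<Rightarrow> complex) list \<Rightarrow> 'v \<Rightarrow> nat" where
  "rho A h = card {i. i < length A \<and> (A ! i) h \<noteq> 0}"

definition line_degree_le ::
    "(complex \<Rightarrow> 'v \<Rightarrow> 'v) \<Rightarrow> ('v::ab_group_add \<Rightarrow> complex) \<Rightarrow> 'v \<Rightarrow> 'v \<Rightarrow> nat \<Rightarrow> bool" where
  "line_degree_le scale f x h d \<longleftrightarrow>
     (\<exists>p :: complex poly. degree p \<le> d \<and> (\<forall>t. f (x + scale t h) = poly p t))"

definition C_zero ::
    "(complex \<Rightarrow> 'v \<Rightarrow> 'v) \<Rightarrow> ('v::ab_group_add \<Rightarrow> complex) list \<Rightarrow> ('v \<Rightarrow> complex) set" where
  "C_zero scale A =
     {f \<in> poly_functions scale. \<forall>h x. h \<noteq> 0 \<longrightarrow> line_degree_le scale f x h (rho A h)}"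

text \<open>Hilbert series of a graded space of polynomial functions. All graded pieces are
  finite-dimensional when \<open>V\<close> is; rational coefficients make the Laurent series a field.\<close>

definition hilbert_series ::
    "(complex \<Rightarrow> 'v \<Rightarrow> 'v) \<Rightarrow> ('v::ab_group_add \<Rightarrow> complex) set \<Rightarrow> rat fps" where
  "hilbert_series scale C =
     Abs_fps (\<lambda>i. of_nat (cfun.dim (C \<inter> homogeneous_functions scale i)))"

end

theory Submission
  imports Defs
begin

text \<open>
  Deletion and contraction. Let \<open>l\<close> be a nonzero form of the arrangement and \<open>H\<close> its hyperplane.
  Restriction to \<open>H\<close> maps the space of the arrangement to that of the contraction; an element of
  the kernel is \<open>l g\<close>, and comparing degrees on lines shows that \<open>g\<close> belongs to the space of the
  deletion. By induction all these spaces are spanned by the products of subfamilies of the forms,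
  and such products lift from \<open>H\<close>, so restriction is onto. Hence the Hilbert series satisfies
  \<open>h(A) = q h(A - l) + h(A / l)\<close>. The sum over \<open>S\<close> of \<open>q^(n - |S|) (1 - q)^(|S| - r(S))\<close>, which is
  the right-hand side, satisfies the same recursion, and zero forms change neither side.
\<close>

section \<open>Dimensions of finitely generated subspaces\<close>

context vector_space
begin

lemma dim_singleton_zero: "dim {0} = 0"
  using dim_eq_card[of "{}" "{0}"] by (simp add: dependent_def)

text \<open>Spaces of functions may be infinite-dimensional, where \<open>dim\<close> takes the
  default value 0, so monotonicity is stated relative to a finite spanning set.\<close>

lemma dim_mono_finite:
  assumes "V \<subseteq> span W" "finite W"
  shows "dim V \<le> dim W"
proof -
  obtain B where B: "B \<subseteq> W" "independent B" "W \<subseteq> span B" "card B = dim W"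
    by (rule basis_exists)
  have "V \<subseteq> span B"
    using assms(1) B(3) span_minimal[OF _ subspace_span] by blast
  then show ?thesis
    using dim_le_card[of V B] B finite_subset[OF B(1) assms(2)] by simp
qed

end

text \<open>Rank-nullity for a finitely generated subspace of a space of any dimension: a basis of
  the kernel extends to a basis of the span, and the added vectors \<open>D\<close> map to a basis
  of the span of the image.\<close>

lemma (in Vector_Spaces.linear) dim_span_eq_kernel_plus_image:
  assumes "finite S"
  shows "vs1.dim (vs1.span S) = vs1.dim {x \<in> vs1.span S. f x = 0} + vs2.dim (f ` S)"
proof -
  define K where "K = {x \<in> vs1.span S. f x = 0}"
  have subK: "vs1.subspace K"
    unfolding K_def vs1.subspace_def
    by (auto simp: add scale vs1.span_zero vs1.span_add vs1.span_scale)
  obtain BK where BK: "BK \<subseteq> K" "vs1.independent BK" "K \<subseteq> vs1.span BK" "card BK = vs1.dim K"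
    by (rule vs1.basis_exists)
  have spanK: "vs1.span BK = K"
    using BK subK vs1.span_subspace by blast
  obtain B where B: "BK \<subseteq> B" "B \<subseteq> vs1.span S" "vs1.independent B" "vs1.span S \<subseteq> vs1.span B"
    using vs1.maximal_independent_subset_extend[of BK "vs1.span S"] BK K_def by blast
  have spanB: "vs1.span B = vs1.span S"
    using B by (meson subset_antisym vs1.span_minimal vs1.subspace_span)
  have finB: "finite B"
    using vs1.independent_span_bound[OF assms B(3)] B(2) by blast
  define D where "D = B - BK"
  \<comment> \<open>A kernel vector in the span of \<open>D\<close> also lies in the span of
    \<open>BK\<close>. Its coordinates in \<open>B\<close> are supported on both of these disjoint
    sets, so they vanish.\<close>
  have inj: "inj_on f (vs1.span D)"
    unfolding inj_on_iff_eq_0[OF vs1.subspace_span]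
  proof (intro ballI impI)
    fix x assume x: "x \<in> vs1.span D" "f x = 0"
    have "x \<in> vs1.span S"
      using x(1) vs1.span_mono[of D B] spanB D_def by blast
    then have "x \<in> vs1.span BK" using x(2) spanK K_def by blast
    then have "vs1.representation D x b = 0 \<or> vs1.representation BK x b = 0" for b
      using vs1.representation_ne_zero D_def by blast
    moreover have "vs1.representation B x = vs1.representation D x"
      "vs1.representation B x = vs1.representation BK x"
      using vs1.representation_extend[OF B(3)] x(1) \<open>x \<in> vs1.span BK\<close> B(1) D_def by blast+
    ultimately have "vs1.representation B x b = 0" for b
      by metis
    then show "x = 0"
      using vs1.sum_nonzero_representation_eq[OF B(3), of x] \<open>x \<in> vs1.span S\<close> spanB by simp
  qed
  have indD: "vs1.independent D"
    using B(3) vs1.independent_mono[of B D] D_def by blast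
  have ind: "vs2.independent (f ` D)"
    by (rule independent_injective_image[OF indD inj])
  have "vs2.span (f ` D) = vs2.span (f ` B)"
    unfolding span_image
  proof
    show "f ` vs1.span D \<subseteq> f ` vs1.span B"
      using vs1.span_mono[of D B] D_def by blast
    have "f ` B \<subseteq> vs2.span (f ` D)"
    proof
      fix y assume "y \<in> f ` B"
      then obtain b where b: "b \<in> B" "y = f b" by blast
      show "y \<in> vs2.span (f ` D)"
      proof (cases "b \<in> BK")
        case True
        then have "f b = 0" using BK(1) K_def by blast
        then show ?thesis using b(2) by (simp only: vs2.span_zero)
      next
        case False
        then have "b \<in> D" using b(1) by (simp add: D_def)
        then show ?thesis unfolding b(2) by (intro vs2.span_base imageI)
      qed
    qed
    then show "f ` vs1.span B \<subseteq> f ` vs1.span D"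
      by (metis span_image vs2.span_minimal vs2.subspace_span)
  qed
  then have "vs2.span (f ` D) = vs2.span (f ` S)"
    using span_image spanB by metis
  then have "vs2.dim (f ` S) = card (f ` D)"
    using vs2.dim_eq_card ind by blast
  also have "\<dots> = card D"
    by (intro card_image inj_on_subset[OF inj vs1.span_superset])
  finally have "vs2.dim (f ` S) = card D" .
  moreover have "vs1.dim (vs1.span S) = card B"
    using vs1.dim_eq_card[of B S] B(3) spanB by simp
  moreover have "card B = card BK + card D"
    using finB B(1) D_def by (metis card_Diff_subset card_mono finite_subset le_add_diff_inverse)
  ultimately show ?thesis using BK(4) K_def by simp
qed

lemma (in Vector_Spaces.linear) dim_image_eq_finite:
  assumes "finite S" and "\<And>x. x \<in> vs1.span S \<Longrightarrow> f x = 0 \<Longrightarrow> x = 0"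
  shows "vs2.dim (f ` S) = vs1.dim S"
proof -
  have "{x \<in> vs1.span S. f x = 0} = {0}"
    using assms(2) vs1.span_zero by auto
  then show ?thesis
    using dim_span_eq_kernel_plus_image[OF assms(1)] by (simp add: vs1.dim_singleton_zero)
qed

section \<open>Polynomials on lines\<close>

text \<open>Fixing \<open>s\<close> first turns a polynomial in two variables into a polynomial in
  \<open>t\<close> whose coefficients depend polynomially on \<open>s\<close>.\<close>

lemma poly_poly_const_eq_map_poly:
  fixes P :: "'a::comm_ring_1 poly poly"
  shows "poly (poly P [:t:]) s = poly (map_poly (\<lambda>c. poly c s) P) t"
  by (induction P) (simp_all add: map_poly_pCons algebra_simps)

lemma line_degree_le_mono: "line_degree_le scale f x h d \<Longrightarrow> d \<le> e \<Longrightarrow> line_degree_le scale f x h e"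
  unfolding line_degree_le_def using le_trans by blast

lemma line_degree_le_add:
  assumes "line_degree_le scale f x h d" "line_degree_le scale g x h d"
  shows "line_degree_le scale (\<lambda>x. f x + g x) x h d"
proof -
  obtain p q where "degree p \<le> d" "\<forall>t. f (x + scale t h) = poly p t"
    "degree q \<le> d" "\<forall>t. g (x + scale t h) = poly q t"
    using assms unfolding line_degree_le_def by blast
  then show ?thesis
    unfolding line_degree_le_def by (intro exI[of _ "p + q"]) (simp add: degree_add_le)
qed

lemma line_degree_le_mult:
  assumes "line_degree_le scale f x h d" "line_degree_le scale g x h e"
  shows "line_degree_le scale (\<lambda>x. f x * g x) x h (d + e)"
proof -
  obtain p q where *: "degree p \<le> d" "\<forall>t. f (x + scale t h) = poly p t"
    "degree q \<le> e" "\<forall>t. g (x + scale t h) = poly q t"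
    using assms unfolding line_degree_le_def by blast
  have "degree (p * q) \<le> d + e"
    using degree_mult_le[of p q] * by linarith
  then show ?thesis
    unfolding line_degree_le_def using * by (intro exI[of _ "p * q"]) simp
qed

lemma line_degree_le_const: "line_degree_le scale (\<lambda>_. c) x h d"
  unfolding line_degree_le_def by (intro exI[of _ "[:c:]"]) simp

lemma rho_Nil [simp]: "rho [] h = 0"
  by (simp add: rho_def)

lemma rho_Cons [simp]: "rho (l # B) h = (if l h = 0 then 0 else 1) + rho B h"
proof -
  have eq: "{i. i < length (l # B) \<and> ((l # B) ! i) h \<noteq> 0} =
      (if l h = 0 then {} else {0}) \<union> Suc ` {i. i < length B \<and> (B ! i) h \<noteq> 0}"
    (is "?L = ?R")
  proof (rule set_eqI)
    fix i show "i \<in> ?L \<longleftrightarrow> i \<in> ?R" by (cases i) auto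
  qed
  have fin: "finite {i. i < length B \<and> (B ! i) h \<noteq> 0}" by simp
  show ?thesis
    unfolding rho_def eq using fin by (subst card_Un_disjoint) (auto simp: card_image)
qed

lemma rho_map_comp: "rho (map (\<lambda>m. m \<circ> \<pi>) B) h = rho B (\<pi> h)"
  by (induction B) auto

section \<open>Products of subfamilies of linear forms\<close>

definition mult_fun :: "('v \<Rightarrow> complex) \<Rightarrow> ('v \<Rightarrow> complex) \<Rightarrow> 'v \<Rightarrow> complex" where
  "mult_fun l f = (\<lambda>x. l x * f x)"

text \<open>Omitting or choosing the first form matches deletion: \<open>mult_fun l\<close> carries
  products of the deletion to products of the whole family, one degree higher.\<close>

fun subfamily_products :: "('v \<Rightarrow> complex) list \<Rightarrow> nat \<Rightarrow> ('v \<Rightarrow> complex) set" where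
  "subfamily_products [] d = (if d = 0 then {\<lambda>_. 1} else {})"
| "subfamily_products (l # B) 0 = subfamily_products B 0"
| "subfamily_products (l # B) (Suc d) =
     subfamily_products B (Suc d) \<union> mult_fun l ` subfamily_products B d"

lemma finite_subfamily_products [simp]: "finite (subfamily_products A d)"
  by (induction A d rule: subfamily_products.induct) auto

lemma subfamily_products_0 [simp]: "subfamily_products A 0 = {\<lambda>_. 1}"
  by (induction A) auto

lemma subfamily_products_mono: "subfamily_products B d \<subseteq> subfamily_products (l # B) d"
  by (cases d) auto

text \<open>Applied to the projection onto a hyperplane, this lifts every product for the
  contraction to a product of the original forms.\<close>

lemma subfamily_products_map_comp:
  "subfamily_products (map (\<lambda>m. m \<circ> \<pi>) B) d = (\<lambda>f. f \<circ> \<pi>) ` subfamily_products B d"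
proof (induction B arbitrary: d)
  case Nil
  then show ?case by (auto simp: comp_def)
next
  case (Cons l B)
  show ?case
  proof (cases d)
    case 0
    then show ?thesis by (simp add: comp_def)
  next
    case (Suc e)
    have "mult_fun (l \<circ> \<pi>) ` (\<lambda>f. f \<circ> \<pi>) ` S = (\<lambda>f. f \<circ> \<pi>) ` mult_fun l ` S" for S
      by (simp add: image_image mult_fun_def comp_def)
    then show ?thesis by (simp only: Suc Cons list.map subfamily_products.simps image_Un)
  qed
qed

lemma linear_mult_fun: "Vector_Spaces.linear fun_scale fun_scale (mult_fun l)"
  unfolding Vector_Spaces.linear_iff
  by (auto simp: cfun.vector_space_axioms mult_fun_def fun_scale_def fun_eq_iff algebra_simps)

lemma linear_comp_right: "Vector_Spaces.linear fun_scale fun_scale (\<lambda>f. f \<circ> \<pi>)"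
  unfolding Vector_Spaces.linear_iff
  by (auto simp: cfun.vector_space_axioms fun_scale_def fun_eq_iff)

lemma span_subfamily_products_zero:
  "cfun.span (subfamily_products ((\<lambda>_. 0) # B) d) = cfun.span (subfamily_products B d)"
proof (cases d)
  case (Suc e)
  have "subfamily_products ((\<lambda>_. 0) # B) d \<subseteq> cfun.span (subfamily_products B d)"
    using Suc cfun.span_zero by (auto intro: cfun.span_base simp: mult_fun_def zero_fun_def)
  then show ?thesis
    by (meson cfun.span_minimal cfun.span_mono cfun.subspace_span subfamily_products_mono subset_antisym)
qed simp

section \<open>Graded pieces of the space of an arrangement\<close>

locale complex_space = vector_space scale
  for scale :: "complex \<Rightarrow> 'v::ab_group_add \<Rightarrow> 'v"
begin

abbreviation "dual \<equiv> dual_space scale"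
abbreviation "homog \<equiv> homogeneous_functions scale"
abbreviation "polys \<equiv> poly_functions scale"

definition graded_piece :: "('v \<Rightarrow> complex) list \<Rightarrow> nat \<Rightarrow> ('v \<Rightarrow> complex) set" where
  "graded_piece A d = C_zero scale A \<inter> homog d"

lemma dual_iff:
  "l \<in> dual \<longleftrightarrow> (\<forall>x y. l (x + y) = l x + l y) \<and> (\<forall>c x. l (scale c x) = c * l x)"
proof -
  have "vector_space ((*) :: complex \<Rightarrow> _)"
    by unfold_locales (simp_all add: algebra_simps)
  then show ?thesis
    by (simp add: dual_space_def Vector_Spaces.linear_iff vector_space_axioms)
qed

lemma dual_zero: "l \<in> dual \<Longrightarrow> l 0 = 0"
  unfolding dual_iff by (metis add_cancel_right_right)

lemma dual_diff: "l \<in> dual \<Longrightarrow> l (x - y) = l x - l y"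
  unfolding dual_iff by (metis add_diff_cancel_right' diff_add_cancel)

lemma line_degree_le_dual:
  assumes "l \<in> dual"
  shows "line_degree_le scale l x h (if l h = 0 then 0 else 1)"
  unfolding line_degree_le_def
  using assms by (intro exI[of _ "[:l x, l h:]"]) (auto simp: dual_iff)

text \<open>The outer variable is \<open>t\<close> and the coefficients are polynomials in
  \<open>s\<close>. Thus a bound on the degree in \<open>t\<close> can be carried from one parallel
  line to another by looking at single coefficients.\<close>

lemma polys_on_plane:
  assumes "f \<in> polys"
  shows "\<exists>P :: complex poly poly. \<forall>s t. f (x + scale s u + scale t h) = poly (poly P [:t:]) s"
  using assms
proof induction
  case (const c)
  show ?case by (intro exI[of _ "[:[:c:]:]"]) simp
next
  case (linear l)
  then show ?case
    by (intro exI[of _ "[:[:l x, l u:], [:l h:]:]"]) (simp add: dual_iff algebra_simps)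
next
  case (add f g)
  then obtain P Q where
    "\<forall>s t. f (x + scale s u + scale t h) = poly (poly P [:t:]) s"
    "\<forall>s t. g (x + scale s u + scale t h) = poly (poly Q [:t:]) s"
    by blast
  then show ?case by (intro exI[of _ "P + Q"]) simp
next
  case (mult f g)
  then obtain P Q where
    "\<forall>s t. f (x + scale s u + scale t h) = poly (poly P [:t:]) s"
    "\<forall>s t. g (x + scale s u + scale t h) = poly (poly Q [:t:]) s"
    by blast
  then show ?case by (intro exI[of _ "P * Q"]) simp
qed

lemma polys_scale: "f \<in> polys \<Longrightarrow> fun_scale c f \<in> polys"
  unfolding fun_scale_def by (rule poly_functions.mult[OF poly_functions.const])

lemma subspace_polys: "cfun.subspace polys"
  unfolding cfun.subspace_def plus_fun_def zero_fun_def
  by (simp add: poly_functions.const poly_functions.add polys_scale)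

lemma prod_list_in_polys: "set ls \<subseteq> dual \<Longrightarrow> (\<lambda>x. \<Prod>l\<leftarrow>ls. l x) \<in> polys"
  by (induction ls) (auto intro: poly_functions.intros)

lemma homog_subset_polys: "homog d \<subseteq> polys"
  unfolding homogeneous_functions_def
  by (rule cfun.span_minimal[OF _ subspace_polys]) (use prod_list_in_polys in blast)

lemma subspace_homog: "cfun.subspace (homog d)"
  unfolding homogeneous_functions_def by (rule cfun.subspace_span)

lemma homog_prod_list: "set ls \<subseteq> dual \<Longrightarrow> length ls = d \<Longrightarrow> (\<lambda>x. \<Prod>l\<leftarrow>ls. l x) \<in> homog d"
  unfolding homogeneous_functions_def by (rule cfun.span_base) blast

lemma homog_mult_dual:
  assumes "l \<in> dual" "f \<in> homog d"
  shows "mult_fun l f \<in> homog (Suc d)"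
proof -
  interpret T: Vector_Spaces.linear fun_scale fun_scale "mult_fun l" by (rule linear_mult_fun)
  have "mult_fun l ` {\<lambda>x. \<Prod>l\<leftarrow>ls. l x | ls. length ls = d \<and> set ls \<subseteq> dual} \<subseteq> homog (Suc d)"
  proof (clarsimp)
    fix ls assume "d = length ls" "set ls \<subseteq> dual"
    then show "mult_fun l (\<lambda>x. \<Prod>l\<leftarrow>ls. l x) \<in> homog (Suc (length ls))"
      using homog_prod_list[of "l # ls"] assms(1) by (simp add: mult_fun_def)
  qed
  then have "mult_fun l ` homog d \<subseteq> homog (Suc d)"
    unfolding homogeneous_functions_def[of scale d] T.span_image[symmetric]
    by (rule cfun.span_minimal[OF _ subspace_homog])
  then show ?thesis using assms(2) by blast
qed

lemma subspace_C_zero: "cfun.subspace (C_zero scale A)"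
  unfolding cfun.subspace_def
proof (intro conjI ballI allI)
  show "0 \<in> C_zero scale A"
    by (simp add: C_zero_def zero_fun_def line_degree_le_const poly_functions.const)
next
  fix f g assume "f \<in> C_zero scale A" "g \<in> C_zero scale A"
  then show "f + g \<in> C_zero scale A"
    by (simp add: C_zero_def plus_fun_def line_degree_le_add poly_functions.add)
next
  fix c f assume f: "f \<in> C_zero scale A"
  have "line_degree_le scale (fun_scale c f) x h (rho A h)" if "h \<noteq> 0" for x h
    using line_degree_le_mult[OF line_degree_le_const[of scale c x h 0], of f "rho A h"] f that
    by (simp add: C_zero_def fun_scale_def)
  then show "fun_scale c f \<in> C_zero scale A"
    using f polys_scale by (auto simp: C_zero_def)
qed

lemma subspace_graded_piece: "cfun.subspace (graded_piece A d)"
  unfolding graded_piece_def by (rule cfun.subspace_inter[OF subspace_C_zero subspace_homog])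

lemma subfamily_products_homog:
  assumes "set A \<subseteq> dual" "f \<in> subfamily_products A d"
  shows "f \<in> homog d"
  using assms
proof (induction A d arbitrary: f rule: subfamily_products.induct)
  case (1 d)
  then show ?case using homog_prod_list[of "[]" 0] by (simp split: if_splits)
qed (auto intro: homog_mult_dual)

text \<open>On a line of direction \<open>h\<close> a form is constant if it vanishes at
  \<open>h\<close> and has degree at most 1 otherwise, so only the forms counted by
  \<open>rho A h\<close> can raise the degree of a product.\<close>

lemma subfamily_products_line_degree:
  assumes "set A \<subseteq> dual" "f \<in> subfamily_products A d"
  shows "line_degree_le scale f x h (rho A h)"
  using assms
proof (induction A d arbitrary: f rule: subfamily_products.induct)
  case (1 d)
  then show ?case by (simp add: line_degree_le_const split: if_splits)
next
  case (2 l B)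
  then show ?case by (simp add: line_degree_le_const)
next
  case (3 l B d)
  from 3(4) consider "f \<in> subfamily_products B (Suc d)"
    | g where "g \<in> subfamily_products B d" "f = mult_fun l g" by auto
  then show ?case
  proof cases
    case 1
    then show ?thesis using 3(1)[of f] 3(3) by (auto elim: line_degree_le_mono)
  next
    case 2
    then show ?thesis
      using 3(2)[of g] 3(3) line_degree_le_mult[OF line_degree_le_dual]
      by (simp add: mult_fun_def)
  qed
qed

lemma span_subfamily_products_subset:
  assumes "set A \<subseteq> dual"
  shows "cfun.span (subfamily_products A d) \<subseteq> graded_piece A d"
proof (rule cfun.span_minimal[OF _ subspace_graded_piece])
  show "subfamily_products A d \<subseteq> graded_piece A d"
    using subfamily_products_homog[OF assms] subfamily_products_line_degree[OF assms]
      homog_subset_polys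
    unfolding graded_piece_def C_zero_def by blast
qed

text \<open>Here \<open>rho\<close> is 0, so a member is constant on every line through the origin
  and hence constant. In positive degree it also vanishes at the origin, so it is zero.\<close>

lemma graded_piece_Nil: "graded_piece [] d = cfun.span (subfamily_products [] d)"
proof
  show "graded_piece [] d \<subseteq> cfun.span (subfamily_products [] d)"
  proof
    fix f assume f: "f \<in> graded_piece [] d"
    have const: "f h = f 0" for h
    proof (cases "h = 0")
      case False
      then obtain p where p: "degree p = 0" "\<forall>t. f (0 + scale t h) = poly p t"
        using f unfolding graded_piece_def C_zero_def line_degree_le_def rho_Nil by blast
      from p(1) obtain c where "p = [:c:]" by (metis degree_eq_zeroE)
      then show ?thesis
        using p(2)[rule_format, of 0] p(2)[rule_format, of 1] by simp
    qed simp
    show "f \<in> cfun.span (subfamily_products [] d)"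
    proof (cases d)
      case 0
      have "f = fun_scale (f 0) (\<lambda>_. 1)"
        using const by (auto simp: fun_scale_def fun_eq_iff)
      also have "\<dots> \<in> cfun.span {\<lambda>_. 1}"
        by (intro cfun.span_scale cfun.span_base singletonI)
      finally show ?thesis
        using 0 by simp
    next
      case (Suc e)
      have "homog d \<subseteq> {g. g 0 = 0}"
        unfolding homogeneous_functions_def
      proof (rule cfun.span_minimal)
        show "cfun.subspace {g :: 'v \<Rightarrow> complex. g 0 = 0}"
          by (simp add: cfun.subspace_def fun_scale_def)
        show "{\<lambda>x. \<Prod>l\<leftarrow>ls. l x | ls. length ls = d \<and> set ls \<subseteq> dual} \<subseteq> {g. g 0 = 0}"
          using Suc dual_zero by (auto simp: length_Suc_conv)
      qed
      then have "f = 0"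
        using f const by (auto simp: graded_piece_def fun_eq_iff)
      then show ?thesis by (simp only: cfun.span_zero)
    qed
  qed
qed (simp add: span_subfamily_products_subset del: subfamily_products.simps)

end

section \<open>Deletion and contraction by a nonzero form\<close>

locale nonzero_form = complex_space scale
  for scale :: "complex \<Rightarrow> 'v::ab_group_add \<Rightarrow> 'v" +
  fixes l :: "'v \<Rightarrow> complex" and u :: 'v
  assumes form: "l \<in> dual" and form_u: "l u = 1"
begin

text \<open>Pulling back along the projection onto the hyperplane of \<open>l\<close> models the contraction
  by \<open>l\<close> on \<open>V\<close> itself: \<open>u\<close> is a direction on which all pulled back forms vanish, so the
  members of the contracted space do not depend on it.\<close>

definition proj :: "'v \<Rightarrow> 'v" where
  "proj x = x - scale (l x) u"

abbreviation contract :: "('v \<Rightarrow> complex) list \<Rightarrow> ('v \<Rightarrow> complex) list" where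
  "contract B \<equiv> map (\<lambda>m. m \<circ> proj) B"

lemma proj_line: "proj (x + scale t h) = proj x + scale t (proj h)"
  using form by (simp add: proj_def dual_iff scale_left_distrib scale_right_diff_distrib)

lemma form_proj: "l (proj x) = 0"
  using form form_u by (simp add: proj_def dual_diff dual_iff)

lemma dual_comp_proj:
  assumes "m \<in> dual"
  shows "m \<circ> proj \<in> dual"
proof -
  have "proj (x + y) = proj x + proj y" "proj (scale c x) = scale c (proj x)" for x y c
    using proj_line[of x 1 y] proj_line[of 0 c x] dual_zero[OF form] by (simp_all add: proj_def)
  then show ?thesis
    using assms by (simp add: dual_iff)
qed

lemma set_contract: "set B \<subseteq> dual \<Longrightarrow> set (contract B) \<subseteq> dual"
  using dual_comp_proj by auto

lemma polys_comp_proj: "f \<in> polys \<Longrightarrow> f \<circ> proj \<in> polys"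
proof (induction rule: poly_functions.induct)
  case (linear m)
  then show ?case by (intro poly_functions.linear dual_comp_proj)
qed (auto simp: comp_def intro: poly_functions.intros)

lemma homog_comp_proj:
  assumes "f \<in> homog d"
  shows "f \<circ> proj \<in> homog d"
proof -
  interpret T: Vector_Spaces.linear fun_scale fun_scale "\<lambda>f :: 'v \<Rightarrow> complex. f \<circ> proj"
    by (rule linear_comp_right)
  have "(\<lambda>f. f \<circ> proj) ` {\<lambda>x. \<Prod>l\<leftarrow>ls. l x | ls. length ls = d \<and> set ls \<subseteq> dual} \<subseteq> homog d"
  proof (clarsimp)
    fix ls assume "d = length ls" "set ls \<subseteq> dual"
    then show "(\<lambda>x. \<Prod>l\<leftarrow>ls. l x) \<circ> proj \<in> homog (length ls)"
      using homog_prod_list[of "contract ls"] set_contract by (simp add: comp_def)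
  qed
  then have "(\<lambda>f. f \<circ> proj) ` homog d \<subseteq> homog d"
    unfolding homogeneous_functions_def T.span_image[symmetric]
    by (rule cfun.span_minimal[OF _ cfun.subspace_span])
  then show ?thesis using assms by blast
qed

text \<open>The projection sends a line of direction \<open>h\<close> to one of direction
  \<open>proj h\<close>, to which \<open>l\<close> contributes nothing, so the two bounds agree. If
  \<open>proj h\<close> is 0, the line collapses to a point.\<close>

lemma graded_piece_comp_proj:
  assumes "f \<in> graded_piece (l # B) d"
  shows "f \<circ> proj \<in> graded_piece (contract B) d"
proof -
  have "line_degree_le scale (f \<circ> proj) x h (rho (contract B) h)" if "h \<noteq> 0" for x h
  proof (cases "proj h = 0")
    case True
    then show ?thesis
      unfolding line_degree_le_def
      by (intro exI[of _ "[:f (proj x):]"]) (simp add: proj_line)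
  next
    case False
    then have "line_degree_le scale f (proj x) (proj h) (rho (l # B) (proj h))"
      using assms by (simp add: graded_piece_def C_zero_def)
    then show ?thesis
      by (simp add: line_degree_le_def proj_line rho_map_comp form_proj)
  qed
  then show ?thesis
    using assms homog_comp_proj polys_comp_proj by (auto simp: graded_piece_def C_zero_def)
qed

text \<open>A single form differs from its pullback by \<open>m u\<close> times \<open>l\<close>; a
  product is treated by replacing one factor at a time, which keeps the quotient
  homogeneous.\<close>

lemma prod_list_diff_divisible:
  assumes "set ls \<subseteq> dual" "length ls = Suc d"
  shows "\<exists>g\<in>homog d. \<forall>x. (\<Prod>m\<leftarrow>ls. m x) - (\<Prod>m\<leftarrow>ls. m (proj x)) = l x * g x"
  using assms
proof (induction d arbitrary: ls)
  case 0
  then obtain m where m: "ls = [m]" "m \<in> dual" by (auto simp: length_Suc_conv)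
  have "fun_scale (m u) (\<lambda>x. 1) \<in> homog 0"
    using homog_prod_list[of "[]" 0] cfun.subspace_scale[OF subspace_homog] by simp
  moreover have "m x - m (proj x) = l x * m u" for x
    using m by (simp add: proj_def dual_diff) (simp add: dual_iff)
  ultimately show ?case
    using m by (intro bexI[of _ "fun_scale (m u) (\<lambda>x. 1)"]) (simp_all add: fun_scale_def)
next
  case (Suc d)
  then obtain m ms where m: "ls = m # ms" "m \<in> dual" "set ms \<subseteq> dual" "length ms = Suc d"
    by (auto simp: length_Suc_conv)
  with Suc.IH obtain g where g: "g \<in> homog d"
      "\<forall>x. (\<Prod>m\<leftarrow>ms. m x) - (\<Prod>m\<leftarrow>ms. m (proj x)) = l x * g x"
    by blast
  \<comment> \<open>With products P and P' of \<open>ms\<close> at \<open>x\<close> and at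
    \<open>proj x\<close>, write \<open>m x\<close> P - \<open>m (proj x)\<close> P' as
    (\<open>m x - m (proj x)\<close>) P + \<open>m (proj x)\<close> (P - P') and divide by
    \<open>l x\<close>.\<close>
  let ?g = "fun_scale (m u) (\<lambda>x. \<Prod>m\<leftarrow>ms. m x) + mult_fun (m \<circ> proj) g"
  have "?g \<in> homog (Suc d)"
    using m g homog_prod_list homog_mult_dual dual_comp_proj
      cfun.subspace_scale[OF subspace_homog] cfun.subspace_add[OF subspace_homog] by simp
  moreover have "(\<Prod>m\<leftarrow>ls. m x) - (\<Prod>m\<leftarrow>ls. m (proj x)) = l x * ?g x" for x
  proof -
    have "m x = m (proj x) + l x * m u"
      using m by (simp add: proj_def dual_diff) (simp add: dual_iff)
    moreover have "(\<Prod>m\<leftarrow>ms. m (proj x)) = (\<Prod>m\<leftarrow>ms. m x) - l x * g x"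
      using g(2)[rule_format, of x] by (simp add: algebra_simps)
    ultimately show ?thesis
      unfolding m(1) by (simp add: fun_scale_def mult_fun_def ring_distribs mult_ac)
  qed
  ultimately show ?case by blast
qed

lemma homog_diff_divisible:
  assumes "f \<in> homog (Suc d)"
  shows "\<exists>g\<in>homog d. f - (f \<circ> proj) = mult_fun l g"
  using assms unfolding homogeneous_functions_def[of scale "Suc d"]
proof (induction rule: cfun.span_induct_alt)
  case base
  show ?case
    using cfun.subspace_0[OF subspace_homog]
    by (intro bexI[of _ 0]) (auto simp: fun_eq_iff mult_fun_def)
next
  case (step c p f)
  then obtain ls where ls: "p = (\<lambda>x. \<Prod>l\<leftarrow>ls. l x)" "length ls = Suc d" "set ls \<subseteq> dual"
    by blast
  obtain g1 where g1: "g1 \<in> homog d" "\<forall>x. p x - p (proj x) = l x * g1 x"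
    using prod_list_diff_divisible[OF ls(3,2)] ls(1) by blast
  obtain g2 where g2: "g2 \<in> homog d" "f - (f \<circ> proj) = mult_fun l g2"
    using step by blast
  have "fun_scale c g1 + g2 \<in> homog d"
    using g1 g2 cfun.subspace_scale[OF subspace_homog] cfun.subspace_add[OF subspace_homog] by simp
  moreover have "(fun_scale c p + f) x - (fun_scale c p + f) (proj x) = l x * (fun_scale c g1 + g2) x" for x
  proof -
    have "f x - f (proj x) = l x * g2 x"
      using fun_cong[OF g2(2), of x] by (simp add: mult_fun_def)
    then show ?thesis
      using arg_cong[OF g1(2)[rule_format, of x], of "(*) c"]
      by (simp add: fun_scale_def algebra_simps)
  qed
  ultimately show ?case
    by (intro bexI[of _ "fun_scale c g1 + g2"]) (auto simp: fun_eq_iff mult_fun_def)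
qed

text \<open>On such a line \<open>l\<close> is a polynomial of degree exactly 1, so dividing by it
  lowers the degree by one.\<close>

lemma line_degree_quotient_transversal:
  assumes "g \<in> polys" "l h \<noteq> 0" "line_degree_le scale (mult_fun l g) x h (Suc d)"
  shows "line_degree_le scale g x h d"
proof -
  \<comment> \<open>Taking 0 in place of \<open>u\<close> degenerates the plane to the line
    itself.\<close>
  obtain P :: "complex poly poly" where P: "\<forall>s t. g (x + scale s 0 + scale t h) = poly (poly P [:t:]) s"
    using polys_on_plane[OF assms(1)] by blast
  define p where "p = map_poly (\<lambda>c. poly c 0) P"
  have p: "g (x + scale t h) = poly p t" for t
    using P[rule_format, of 0 t] by (simp add: p_def poly_poly_const_eq_map_poly)
  obtain q where q: "degree q \<le> Suc d" "\<forall>t. mult_fun l g (x + scale t h) = poly q t"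
    using assms(3) unfolding line_degree_le_def by blast
  have "poly q t = poly ([:l x, l h:] * p) t" for t
    using q(2)[rule_format, of t] p form by (simp add: mult_fun_def dual_iff algebra_simps)
  then have "q = [:l x, l h:] * p"
    by (simp add: poly_eq_poly_eq_iff[symmetric] fun_eq_iff)
  then have "degree p \<le> d"
    using q(1) assms(2) by (cases "p = 0") (simp_all add: degree_mult_eq del: mult_pCons_left)
  then show ?thesis
    unfolding line_degree_le_def using p by blast
qed

text \<open>On lines inside the hyperplane of \<open>l\<close> the bound for \<open>l g\<close> says nothing about \<open>g\<close>;
  it is inherited from the nearby parallel lines.\<close>

lemma line_degree_quotient_parallel:
  assumes "g \<in> polys" "l h = 0" "\<And>x. line_degree_le scale (mult_fun l g) x h d"
  shows "line_degree_le scale g x h d"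
proof -
  obtain P :: "complex poly poly" where P: "\<forall>s t. g (x + scale s u + scale t h) = poly (poly P [:t:]) s"
    using polys_on_plane[OF assms(1)] by blast
  define p where "p s = map_poly (\<lambda>c. poly c s) P" for s
  have p: "g (x + scale s u + scale t h) = poly (p s) t" for s t
    using P by (simp add: p_def poly_poly_const_eq_map_poly)
  \<comment> \<open>On the line shifted by \<open>s\<close> along \<open>u\<close> the form
    \<open>l\<close> is the constant \<open>l x + s\<close>, which can be divided out unless it is
    0.\<close>
  have deg: "degree (p s) \<le> d" if s: "s \<noteq> - l x" for s
  proof -
    obtain q where q: "degree q \<le> d" "\<forall>t. mult_fun l g (x + scale s u + scale t h) = poly q t"
      using assms(3) unfolding line_degree_le_def by blast
    have "poly q t = poly (smult (l x + s) (p s)) t" for t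
      using q(2)[rule_format, of t] p[of s t] form form_u assms(2) by (simp add: mult_fun_def dual_iff)
    then have "q = smult (l x + s) (p s)"
      by (simp add: poly_eq_poly_eq_iff[symmetric] fun_eq_iff)
    moreover have "l x + s \<noteq> 0"
      using s by (metis add.commute eq_neg_iff_add_eq_0)
    ultimately show ?thesis using q(1) by simp
  qed
  \<comment> \<open>A coefficient of order above \<open>d\<close> is a polynomial in
    \<open>s\<close> vanishing at all but one point, hence zero; this also covers the original line
    \<open>s = 0\<close>.\<close>
  have "coeff P k = 0" if "k > d" for k
  proof (rule ccontr)
    assume "coeff P k \<noteq> 0"
    then have "finite {s. poly (coeff P k) s = 0}" by (rule poly_roots_finite)
    moreover have "- {- l x} \<subseteq> {s. poly (coeff P k) s = 0}"
    proof
      fix s assume "s \<in> - {- l x}"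
      then have "coeff (p s) k = 0"
        using deg[of s] that by (intro coeff_eq_0) simp
      then show "s \<in> {s. poly (coeff P k) s = 0}"
        by (simp add: p_def coeff_map_poly)
    qed
    ultimately have "finite (- {- l x})" by (rule rev_finite_subset)
    then show False
      using finite_compl[of "{- l x}"] infinite_UNIV_char_0[where 'a = complex] by simp
  qed
  then have "degree (p 0) \<le> d"
    by (intro degree_le) (simp add: p_def coeff_map_poly)
  then show ?thesis
    unfolding line_degree_le_def using p[of 0] by auto
qed

text \<open>Removing \<open>l\<close> lowers \<open>rho\<close> by one exactly in the transversal
  directions, where the quotient loses one degree; in parallel directions both are
  unchanged.\<close>

lemma graded_piece_quotient:
  assumes "g \<in> homog d" "mult_fun l g \<in> C_zero scale (l # B)"
  shows "g \<in> graded_piece B d"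
proof -
  have g: "g \<in> polys" using assms(1) homog_subset_polys by blast
  have deg: "line_degree_le scale (mult_fun l g) x h (rho (l # B) h)" if "h \<noteq> 0" for x h
    using assms(2) that by (simp add: C_zero_def)
  have "line_degree_le scale g x h (rho B h)" if "h \<noteq> 0" for x h
    using line_degree_quotient_transversal[OF g, of h x "rho B h"]
      line_degree_quotient_parallel[OF g, of h "rho B h" x] deg[OF that]
    by (cases "l h = 0") auto
  then show ?thesis
    using assms(1) g by (simp add: graded_piece_def C_zero_def)
qed

text \<open>If the pullback is zero, then \<open>f\<close> equals
  \<open>f - (f \<circ> proj)\<close>, which is divisible by \<open>l\<close> with a homogeneous
  quotient.\<close>

lemma kernel_comp_proj:
  assumes "f \<in> graded_piece (l # B) (Suc d)" "f \<circ> proj = 0"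
  shows "f \<in> mult_fun l ` graded_piece B d"
proof -
  obtain g where g: "g \<in> homog d" "f - (f \<circ> proj) = mult_fun l g"
    using homog_diff_divisible assms(1) by (auto simp: graded_piece_def)
  then have "f = mult_fun l g" using assms(2) by simp
  then show ?thesis
    using g(1) assms(1) graded_piece_quotient by (auto simp: graded_piece_def)
qed

text \<open>Spanning for the contraction yields a combination \<open>p\<close> of products from
  \<open>B\<close> with the same restriction as \<open>f\<close>. The difference is \<open>l\<close>
  times a member of the deletion, which is again spanned by products.\<close>

lemma graded_piece_Cons:
  assumes B: "set B \<subseteq> dual"
    and del: "\<And>d. graded_piece B d = cfun.span (subfamily_products B d)"
    and con: "\<And>d. graded_piece (contract B) d = cfun.span (subfamily_products (contract B) d)"
  shows "graded_piece (l # B) d = cfun.span (subfamily_products (l # B) d)"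
proof
  show "cfun.span (subfamily_products (l # B) d) \<subseteq> graded_piece (l # B) d"
    using span_subfamily_products_subset[of "l # B" d] B form by simp
  show "graded_piece (l # B) d \<subseteq> cfun.span (subfamily_products (l # B) d)"
  proof (cases d)
    case 0
    \<comment> \<open>In degree 0 no quotient by \<open>l\<close> is available, but the empty
      product spans everything.\<close>
    have "homog 0 = cfun.span {\<lambda>_. 1}"
      by (simp add: homogeneous_functions_def)
    then show ?thesis using 0 by (auto simp: graded_piece_def)
  next
    case (Suc e)
    interpret T: Vector_Spaces.linear fun_scale fun_scale "\<lambda>f :: 'v \<Rightarrow> complex. f \<circ> proj"
      by (rule linear_comp_right)
    interpret M: Vector_Spaces.linear fun_scale fun_scale "mult_fun l"
      by (rule linear_mult_fun)
    show ?thesis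
    proof
      fix f assume f: "f \<in> graded_piece (l # B) d"
      have "f \<circ> proj \<in> (\<lambda>f. f \<circ> proj) ` cfun.span (subfamily_products B d)"
        using graded_piece_comp_proj[OF f] unfolding con subfamily_products_map_comp T.span_image .
      then obtain p where p: "p \<in> cfun.span (subfamily_products B d)" "f \<circ> proj = p \<circ> proj"
        by blast
      have p': "p \<in> cfun.span (subfamily_products (l # B) d)"
        using p(1) cfun.span_mono[OF subfamily_products_mono] by blast
      then have "p \<in> graded_piece (l # B) d"
        using span_subfamily_products_subset[of "l # B" d] B form by auto
      then have "f - p \<in> graded_piece (l # B) (Suc e)"
        using f Suc cfun.subspace_diff[OF subspace_graded_piece] by blast
      moreover have "(f - p) \<circ> proj = 0"
        using p(2) by (simp add: fun_eq_iff)
      ultimately have "f - p \<in> mult_fun l ` cfun.span (subfamily_products B e)"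
        using kernel_comp_proj del by blast
      also have "\<dots> = cfun.span (mult_fun l ` subfamily_products B e)"
        by (rule M.span_image[symmetric])
      also have "\<dots> \<subseteq> cfun.span (subfamily_products (l # B) d)"
        using Suc by (intro cfun.span_mono) simp
      finally show "f \<in> cfun.span (subfamily_products (l # B) d)"
        using cfun.span_add[OF _ p'] by (metis diff_add_cancel)
    qed
  qed
qed

text \<open>This is rank-nullity for the pullback: the kernel is \<open>l\<close> times the
  deletion, one degree lower, and the image spans the piece of the contraction.\<close>

lemma dim_graded_piece_Cons:
  assumes B: "set B \<subseteq> dual"
    and del: "graded_piece B d = cfun.span (subfamily_products B d)"
    and con: "graded_piece (contract B) (Suc d) = cfun.span (subfamily_products (contract B) (Suc d))"
    and all: "graded_piece (l # B) (Suc d) = cfun.span (subfamily_products (l # B) (Suc d))"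
  shows "cfun.dim (graded_piece (l # B) (Suc d)) =
    cfun.dim (graded_piece B d) + cfun.dim (graded_piece (contract B) (Suc d))"
proof -
  interpret T: Vector_Spaces.linear fun_scale fun_scale "\<lambda>f :: 'v \<Rightarrow> complex. f \<circ> proj"
    by (rule linear_comp_right)
  interpret M: Vector_Spaces.linear fun_scale fun_scale "mult_fun l"
    by (rule linear_mult_fun)
  let ?S = "subfamily_products (l # B) (Suc d)"
  have zero: "mult_fun l g \<circ> proj = 0" for g
    by (simp add: mult_fun_def fun_eq_iff form_proj)
  have "{f \<in> cfun.span ?S. f \<circ> proj = 0} = mult_fun l ` graded_piece B d"
  proof
    show "{f \<in> cfun.span ?S. f \<circ> proj = 0} \<subseteq> mult_fun l ` graded_piece B d"
      using kernel_comp_proj all by blast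
    have "mult_fun l ` graded_piece B d \<subseteq> cfun.span ?S"
      unfolding del M.span_image[symmetric] by (intro cfun.span_mono) simp
    then show "mult_fun l ` graded_piece B d \<subseteq> {f \<in> cfun.span ?S. f \<circ> proj = 0}"
      using zero by auto
  qed
  moreover have "cfun.dim (mult_fun l ` graded_piece B d) = cfun.dim (graded_piece B d)"
  proof -
    \<comment> \<open>On the line through \<open>x\<close> in direction \<open>u\<close> the form
      \<open>l\<close> has a single zero, so the polynomial \<open>g\<close> vanishes at infinitely
      many points of it, hence also at \<open>x\<close>.\<close>
    have "g = 0" if "g \<in> cfun.span (subfamily_products B d)" "mult_fun l g = 0" for g
    proof -
      have "g \<in> polys"
        using that(1) del homog_subset_polys by (auto simp: graded_piece_def)
      have "g x = 0" for x
      proof -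
        obtain P :: "complex poly poly"
          where P: "\<forall>s t. g (x + scale s u + scale t 0) = poly (poly P [:t:]) s"
          using polys_on_plane[OF \<open>g \<in> polys\<close>] by blast
        define p where "p = poly P 0"
        have p: "g (x + scale s u) = poly p s" for s
          using P[rule_format, of s 0] by (simp add: p_def)
        have "poly p s = 0" if "s \<noteq> - l x" for s
        proof -
          have "l (x + scale s u) \<noteq> 0"
            using form form_u that by (metis add.commute dual_iff eq_neg_iff_add_eq_0 mult.right_neutral)
          then show ?thesis
            using fun_cong[OF \<open>mult_fun l g = 0\<close>, of "x + scale s u"] p[of s]
            by (simp add: mult_fun_def)
        qed
        then have "- {- l x} \<subseteq> {s. poly p s = 0}" by blast
        then have "p = 0"
          using poly_roots_finite[of p] finite_subset infinite_UNIV_char_0[where 'a = complex]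
            finite_compl[of "{- l x}"] by (metis finite.emptyI finite.insertI)
        then show ?thesis using p[of 0] by simp
      qed
      then show ?thesis by (simp add: fun_eq_iff)
    qed
    then have "cfun.dim (mult_fun l ` subfamily_products B d) = cfun.dim (subfamily_products B d)"
      by (intro M.dim_image_eq_finite) auto
    then show ?thesis
      unfolding del M.span_image[symmetric] by simp
  qed
  \<comment> \<open>Products containing \<open>l\<close> restrict to zero; the others restrict to
    all products of the contraction.\<close>
  moreover have "cfun.dim ((\<lambda>f. f \<circ> proj) ` ?S) = cfun.dim (graded_piece (contract B) (Suc d))"
  proof (rule cfun.span_eq_dim)
    have "(\<lambda>f. f \<circ> proj) ` ?S \<subseteq> cfun.span (subfamily_products (contract B) (Suc d))"
      using zero cfun.span_zero
      by (auto intro: cfun.span_base simp: subfamily_products_map_comp)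
    moreover have "subfamily_products (contract B) (Suc d) \<subseteq> (\<lambda>f. f \<circ> proj) ` ?S"
      by (auto simp: subfamily_products_map_comp)
    ultimately show "cfun.span ((\<lambda>f. f \<circ> proj) ` ?S) = cfun.span (graded_piece (contract B) (Suc d))"
      unfolding con cfun.span_span
      by (meson cfun.span_minimal cfun.span_mono cfun.subspace_span subset_antisym)
  qed
  ultimately show ?thesis
    using T.dim_span_eq_kernel_plus_image[of ?S] all by simp
qed

text \<open>Rank-nullity again, now on forms: a form with zero pullback is \<open>m u\<close> times
  \<open>l\<close>, so the kernel is the line spanned by \<open>l\<close> and contraction lowers the
  rank by one.\<close>

lemma dim_insert_form:
  assumes "finite X" "X \<subseteq> dual"
  shows "cfun.dim (insert l X) = Suc (cfun.dim ((\<lambda>m. m \<circ> proj) ` X))"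
proof -
  interpret T: Vector_Spaces.linear fun_scale fun_scale "\<lambda>f :: 'v \<Rightarrow> complex. f \<circ> proj"
    by (rule linear_comp_right)
  have l0: "l \<circ> proj = 0" by (simp add: fun_eq_iff form_proj)
  have "{m \<in> cfun.span (insert l X). m \<circ> proj = 0} = cfun.span {l}"
  proof
    show "{m \<in> cfun.span (insert l X). m \<circ> proj = 0} \<subseteq> cfun.span {l}"
    proof clarify
      fix m assume m: "m \<in> cfun.span (insert l X)" "m \<circ> proj = 0"
      have "cfun.subspace dual"
        by (simp add: cfun.subspace_def dual_iff fun_scale_def algebra_simps)
      then have "m \<in> dual"
        using m(1) cfun.span_minimal[of "insert l X" dual] assms(2) form by blast
      then have "m x - l x * m u = m (proj x)" for x
        by (simp add: proj_def dual_diff) (simp add: dual_iff)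
      moreover have "m (proj x) = 0" for x
        using fun_cong[OF m(2), of x] by simp
      ultimately have "m x = m u * l x" for x
        by (metis eq_iff_diff_eq_0 mult.commute)
      then have "m = fun_scale (m u) l"
        unfolding fun_scale_def by (rule ext)
      then show "m \<in> cfun.span {l}"
        by (metis cfun.span_base cfun.span_scale singletonI)
    qed
    have "cfun.span {l} \<subseteq> {m. m \<circ> proj = 0}"
      using l0 by (auto simp: cfun.span_singleton fun_scale_def fun_eq_iff)
    moreover have "cfun.span {l} \<subseteq> cfun.span (insert l X)"
      by (intro cfun.span_mono) simp
    ultimately show "cfun.span {l} \<subseteq> {m \<in> cfun.span (insert l X). m \<circ> proj = 0}"
      by blast
  qed
  moreover have "cfun.dim (cfun.span {l}) = 1"
  proof -
    have "l \<noteq> 0" using form_u by auto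
    then show ?thesis
      using cfun.dim_span_eq_card_independent[of "{l}"] by simp
  qed
  moreover have "cfun.dim ((\<lambda>m. m \<circ> proj) ` insert l X) = cfun.dim ((\<lambda>m. m \<circ> proj) ` X)"
    using l0 by (intro cfun.span_eq_dim) (simp add: cfun.span_insert_0)
  ultimately show ?thesis
    using T.dim_span_eq_kernel_plus_image[of "insert l X"] assms(1) by simp
qed

end

section \<open>Spanning by products, by induction over arrangements\<close>

context complex_space
begin

lemma nonzero_formI:
  assumes "l \<in> dual" "l \<noteq> (\<lambda>_. 0)"
  obtains u where "nonzero_form scale l u"
proof -
  obtain v where v: "l v \<noteq> 0" using assms(2) by auto
  have "l (scale (1 / l v) v) = 1" using v assms(1) by (simp add: dual_iff)
  then have "nonzero_form scale l (scale (1 / l v) v)"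
    using assms(1) by unfold_locales
  then show thesis by (rule that)
qed

lemma graded_piece_zero_form: "graded_piece ((\<lambda>_. 0) # B) d = graded_piece B d"
  by (simp add: graded_piece_def C_zero_def)

text \<open>The induction runs on the length, not on the list, because the contraction has as many
  forms as \<open>B\<close> but is a different list.\<close>

theorem graded_piece_eq_span:
  assumes "set A \<subseteq> dual"
  shows "graded_piece A d = cfun.span (subfamily_products A d)"
  using assms
proof (induction "length A" arbitrary: A d)
  case 0
  then show ?case using graded_piece_Nil by simp
next
  case (Suc n)
  then obtain l B where A: "A = l # B" "length B = n" by (metis length_Suc_conv)
  with Suc have B: "set B \<subseteq> dual" and l: "l \<in> dual" by auto
  show ?case
  proof (cases "l = (\<lambda>_. 0)")
    case True
    then show ?thesis
      using A B Suc.hyps(1)[of B d] by (simp add: graded_piece_zero_form span_subfamily_products_zero)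
  next
    case False
    then obtain u where "nonzero_form scale l u" using l nonzero_formI by blast
    then interpret nonzero_form scale l u .
    show ?thesis
      unfolding A(1)
      using A B set_contract by (intro graded_piece_Cons Suc.hyps(1)) auto
  qed
qed

section \<open>The rank generating function\<close>

definition hilb :: "('v \<Rightarrow> complex) list \<Rightarrow> rat fps" where
  "hilb A = hilbert_series scale (C_zero scale A)"

lemma hilb_nth: "fps_nth (hilb A) d = of_nat (cfun.dim (graded_piece A d))"
  by (simp add: hilb_def hilbert_series_def graded_piece_def)

end

text \<open>The right-hand side of the theorem with all negative powers of \<open>q\<close> cancelled.\<close>

definition rank_series :: "('v \<Rightarrow> complex) list \<Rightarrow> rat fps" where
  "rank_series A = (\<Sum>S\<in>Pow {..<length A}.
     fps_X ^ (length A - card S) * (1 - fps_X) ^ (card S - matroid_rank A S))"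

lemma matroid_rank_le_card: "finite S \<Longrightarrow> matroid_rank A S \<le> card S"
  unfolding matroid_rank_def cfun.dim_span
  by (meson card_image_le cfun.dim_le_card' finite_imageI le_trans)

lemma matroid_rank_Suc: "matroid_rank (l # B) (Suc ` S) = matroid_rank B S"
  by (simp add: matroid_rank_def image_image)

lemma matroid_rank_insert_0:
  "matroid_rank (l # B) (insert 0 (Suc ` S)) = cfun.dim (insert l ((!) B ` S))"
  by (simp add: matroid_rank_def image_image)

text \<open>Index 0 is the head of a list and \<open>Suc\<close> shifts the indices of its tail, so
  this separates the subfamilies without the head from those with it.\<close>

lemma sum_Pow_lessThan_Suc:
  fixes F :: "nat set \<Rightarrow> 'a::comm_monoid_add"
  shows "sum F (Pow {..<Suc n}) =
    (\<Sum>S\<in>Pow {..<n}. F (Suc ` S)) + (\<Sum>S\<in>Pow {..<n}. F (insert 0 (Suc ` S)))"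
proof -
  have inj: "inj_on ((`) Suc) (Pow {..<n})"
    by (simp add: inj_on_def inj_image_eq_iff)
  have "Pow {..<Suc n} = (`) Suc ` Pow {..<n} \<union> insert 0 ` (`) Suc ` Pow {..<n}"
    unfolding lessThan_Suc_eq_insert_0 Pow_insert image_Pow_surj[OF refl] ..
  moreover have "sum F ((`) Suc ` Pow {..<n}) = (\<Sum>S\<in>Pow {..<n}. F (Suc ` S))"
    using inj by (simp add: sum.reindex)
  moreover have "sum F (insert 0 ` (`) Suc ` Pow {..<n}) = (\<Sum>S\<in>Pow {..<n}. F (insert 0 (Suc ` S)))"
  proof -
    have "inj_on (\<lambda>S. insert 0 (Suc ` S)) (Pow {..<n})"
    proof (rule inj_onI)
      fix S T assume "insert 0 (Suc ` S) = insert 0 (Suc ` T)"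
      then have "Suc ` S = Suc ` T" by (metis image_iff insert_ident nat.distinct(1))
      then show "S = T" by (simp add: inj_image_eq_iff)
    qed
    then show ?thesis by (simp add: image_image sum.reindex)
  qed
  moreover have "(`) Suc ` Pow {..<n} \<inter> insert 0 ` (`) Suc ` Pow {..<n} = {}"
    by auto
  ultimately show ?thesis by (simp add: sum.union_disjoint)
qed

text \<open>A subfamily without the head misses one form more, which gives the factor
  \<open>fps_X\<close>. The sum over the others is left in a form that serves zero and nonzero heads
  alike.\<close>

lemma rank_series_Cons:
  "rank_series (l # B) = fps_X * rank_series B +
    (\<Sum>S\<in>Pow {..<length B}. fps_X ^ (length B - card S) *
      (1 - fps_X) ^ (Suc (card S) - cfun.dim (insert l ((!) B ` S))))"
proof -
  have "rank_series (l # B) =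
    (\<Sum>S\<in>Pow {..<length B}. fps_X ^ (Suc (length B) - card S) * (1 - fps_X) ^ (card S - matroid_rank B S)) +
    (\<Sum>S\<in>Pow {..<length B}. fps_X ^ (length B - card S) *
      (1 - fps_X) ^ (Suc (card S) - cfun.dim (insert l ((!) B ` S))))"
    unfolding rank_series_def length_Cons sum_Pow_lessThan_Suc matroid_rank_Suc matroid_rank_insert_0
    by (intro arg_cong2[where f = "(+)"] sum.cong refl)
      (auto simp: card_image card_insert_if finite_subset)
  moreover have "(\<Sum>S\<in>Pow {..<length B}. fps_X ^ (Suc (length B) - card S) * (1 - fps_X) ^ (card S - matroid_rank B S))
     = fps_X * rank_series B"
    unfolding rank_series_def sum_distrib_left
  proof (intro sum.cong refl)
    fix S assume "S \<in> Pow {..<length B}"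
    then have "card S \<le> length B" using card_mono[of "{..<length B}" S] by simp
    then show "fps_X ^ (Suc (length B) - card S) * (1 - fps_X) ^ (card S - matroid_rank B S) =
      fps_X * (fps_X ^ (length B - card S) * (1 - fps_X :: rat fps) ^ (card S - matroid_rank B S))"
      by (simp add: Suc_diff_le mult.assoc)
  qed
  ultimately show ?thesis by simp
qed

text \<open>Adding a loop raises the cardinality but not the rank, so the second sum gains a factor
  \<open>1 - fps_X\<close>, and the two factors add up to 1.\<close>

lemma rank_series_zero_form: "rank_series ((\<lambda>_. 0) # B) = rank_series B"
proof -
  have "cfun.dim (insert (\<lambda>_. 0) X) = cfun.dim X" for X :: "('a \<Rightarrow> complex) set"
    using cfun.span_eq_dim[OF cfun.span_insert_0[of X]] by (simp add: zero_fun_def)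
  then have "rank_series ((\<lambda>_. 0) # B) = fps_X * rank_series B +
    (\<Sum>S\<in>Pow {..<length B}. fps_X ^ (length B - card S) *
      (1 - fps_X) ^ (Suc (card S) - matroid_rank B S))"
    unfolding rank_series_Cons matroid_rank_def by simp
  also have "(\<Sum>S\<in>Pow {..<length B}. fps_X ^ (length B - card S) *
      (1 - fps_X) ^ (Suc (card S) - matroid_rank B S)) = (1 - fps_X) * rank_series B"
    unfolding rank_series_def sum_distrib_left
  proof (intro sum.cong refl)
    fix S assume "S \<in> Pow {..<length B}"
    then have "matroid_rank B S \<le> card S"
      by (intro matroid_rank_le_card) (auto intro: finite_subset)
    then show "fps_X ^ (length B - card S) * (1 - fps_X) ^ (Suc (card S) - matroid_rank B S) =
      (1 - fps_X) * (fps_X ^ (length B - card S) * (1 - fps_X :: rat fps) ^ (card S - matroid_rank B S))"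
      by (simp add: Suc_diff_le mult_ac)
  qed
  finally show ?thesis by (simp add: algebra_simps)
qed

text \<open>With the head included, both cardinality and rank exceed those in the contraction by
  one, so the exponent is that of the contraction.\<close>

lemma (in nonzero_form) rank_series_nonzero_form:
  assumes "set B \<subseteq> dual"
  shows "rank_series (l # B) = fps_X * rank_series B + rank_series (contract B)"
proof -
  have "cfun.dim (insert l ((!) B ` S)) = Suc (matroid_rank (contract B) S)"
    if S: "S \<subseteq> {..<length B}" for S
  proof -
    have "(\<lambda>m. m \<circ> proj) ` (!) B ` S = (!) (contract B) ` S"
      using S by (auto simp: image_image intro!: image_cong)
    moreover have "(!) B ` S \<subseteq> dual" "finite S"
      using S assms finite_subset by (auto dest: nth_mem)
    ultimately show ?thesis
      using dim_insert_form[of "(!) B ` S"] by (simp add: matroid_rank_def)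
  qed
  then show ?thesis
    unfolding rank_series_Cons unfolding rank_series_def by simp
qed

context complex_space
begin

theorem hilb_eq_rank_series:
  assumes "set A \<subseteq> dual"
  shows "hilb A = rank_series A"
  using assms
proof (induction "length A" arbitrary: A)
  case 0
  have "cfun.dim {\<lambda>_ :: 'v. 1 :: complex} = 1"
    using cfun.dim_eq_card_independent[of "{\<lambda>_ :: 'v. 1 :: complex}"]
    by (simp add: fun_eq_iff)
  moreover have "cfun.dim ({} :: ('v \<Rightarrow> complex) set) = 0"
    using cfun.dim_eq_card_independent[of "{}"] cfun.independent_empty by simp
  ultimately have "hilb [] = 1"
    by (auto simp: fps_eq_iff hilb_nth graded_piece_eq_span)
  then show ?case using 0 by (simp add: rank_series_def)
next
  case (Suc n)
  then obtain l B where A: "A = l # B" "length B = n" by (metis length_Suc_conv)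
  with Suc have B: "set B \<subseteq> dual" and l: "l \<in> dual" by auto
  show ?case
  proof (cases "l = (\<lambda>_. 0)")
    case True
    have "hilb A = hilb B"
      by (simp add: A True fps_eq_iff hilb_nth graded_piece_zero_form)
    then show ?thesis
      using A B Suc.hyps(1)[of B] True by (simp add: rank_series_zero_form)
  next
    case False
    then obtain u where "nonzero_form scale l u" using l nonzero_formI by blast
    then interpret nonzero_form scale l u .
    have C: "set (contract B) \<subseteq> dual" using B by (rule set_contract)
    have "hilb A = fps_X * hilb B + hilb (contract B)"
    proof (rule fps_ext)
      fix d show "fps_nth (hilb A) d = fps_nth (fps_X * hilb B + hilb (contract B)) d"
      proof (cases d)
        \<comment> \<open>In degree 0 the term with \<open>fps_X\<close> contributes nothing, and
          both remaining pieces are spanned by the constant 1.\<close>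
        case 0
        then show ?thesis
          using Suc.prems C by (simp add: hilb_nth graded_piece_eq_span)
      next
        case (Suc e)
        have "cfun.dim (graded_piece A (Suc e)) =
            cfun.dim (graded_piece B e) + cfun.dim (graded_piece (contract B) (Suc e))"
          unfolding A(1)
          using B l C by (intro dim_graded_piece_Cons graded_piece_eq_span) auto
        then show ?thesis using Suc by (simp add: hilb_nth)
      qed
    qed
    then show ?thesis
      using Suc.hyps(1)[of B] Suc.hyps(1)[of "contract B"] A B C rank_series_nonzero_form[OF B] by simp
  qed
qed

end

section \<open>Laurent series and the Tutte polynomial\<close>

lemma fps_to_fls_sum: "fps_to_fls (sum f S) = (\<Sum>x\<in>S. fps_to_fls (f x))"
  by (induction S rule: infinite_finite_induct) auto

text \<open>Since \<open>1 / q - 1 = (1 - q) / q\<close>, the total power of \<open>q\<close> is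
  \<open>n - s\<close> minus \<open>c - s\<close>, that is \<open>n - c\<close>. The inequalities
  keep the natural subtractions from being truncated.\<close>

lemma tutte_term:
  fixes q :: "'a::field"
  assumes "q \<noteq> 0" "s \<le> c" "c \<le> n" "s \<le> r" "r \<le> n"
  shows "q ^ (n - r) * ((1 + q - 1) ^ (r - s) * (1 / q - 1) ^ (c - s)) = q ^ (n - c) * (1 - q) ^ (c - s)"
proof -
  have "1 / q - 1 = (1 - q) / q"
    using assms(1) by (simp add: diff_divide_distrib)
  then have "q ^ (n - r) * ((1 + q - 1) ^ (r - s) * (1 / q - 1) ^ (c - s)) =
      q ^ ((n - r) + (r - s)) * (1 - q) ^ (c - s) / q ^ (c - s)"
    by (simp add: power_add power_divide)
  also have "(n - r) + (r - s) = (n - c) + (c - s)"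
    using assms by simp
  finally show ?thesis
    using assms(1) by (simp add: power_add)
qed

lemma rank_series_eq_tutte:
  "fps_to_fls (rank_series A) =
    fls_X ^ (length A - arrangement_rank A) * tutte A (1 + fls_X) (1 / fls_X)"
proof -
  have "fps_to_fls (rank_series A) = (\<Sum>S\<in>Pow {..<length A}.
      fls_X ^ (length A - card S) * (1 - fls_X) ^ (card S - matroid_rank A S))"
    unfolding rank_series_def by (simp add: fps_to_fls_sum fls_times_fps_to_fls fps_to_fls_power)
  also have "\<dots> = fls_X ^ (length A - arrangement_rank A) * tutte A (1 + fls_X) (1 / fls_X)"
    unfolding tutte_def sum_distrib_left
  proof (intro sum.cong refl)
    fix S assume "S \<in> Pow {..<length A}"
    then have S: "S \<subseteq> {..<length A}" "finite S" by (auto intro: finite_subset)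
    \<comment> \<open>The comparison is made term by term; the bounds below are rank at most
      cardinality and monotonicity of rank and cardinality.\<close>
    define n r c s where "n = length A" and "r = arrangement_rank A" and "c = card S"
      and "s = matroid_rank A S"
    have "s \<le> c" unfolding s_def c_def using S by (intro matroid_rank_le_card)
    have "c \<le> n" unfolding c_def n_def using S card_mono[of "{..<length A}" S] by simp
    have "r \<le> n"
      unfolding r_def n_def arrangement_rank_def cfun.dim_span
      using cfun.dim_le_card'[of "set A"] card_length[of A] by simp
    have "s \<le> r"
      unfolding s_def r_def arrangement_rank_def matroid_rank_def cfun.dim_span
      using S by (intro cfun.dim_mono_finite) (auto intro!: cfun.span_base dest!: subsetD)
    show "fls_X ^ (length A - card S) * (1 - fls_X) ^ (card S - matroid_rank A S) =
      fls_X ^ (length A - arrangement_rank A) * ((1 + fls_X - 1) ^ (arrangement_rank A - matroid_rank A S) *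
        (1 / fls_X - 1 :: rat fls) ^ (card S - matroid_rank A S))"
      using tutte_term[OF fls_X_nonzero \<open>s \<le> c\<close> \<open>c \<le> n\<close> \<open>s \<le> r\<close> \<open>r \<le> n\<close>]
      unfolding n_def r_def c_def s_def by (rule sym)
  qed
  finally show ?thesis .
qed

theorem corollary4p13:
  fixes scale :: "complex \<Rightarrow> 'v::ab_group_add \<Rightarrow> 'v"
    and Basis :: "'v set"
    and A :: "('v \<Rightarrow> complex) list"
    and n r :: nat
  assumes "finite_dimensional_vector_space scale Basis"
    and "set A \<subseteq> dual_space scale"
    and "length A = n"
    and "arrangement_rank A = r"
  shows "fps_to_fls (hilbert_series scale (C_zero scale A)) =
    fls_X ^ (n - r) * tutte A (1 + fls_X) (1 / fls_X)"
proof -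
  interpret finite_dimensional_vector_space scale Basis by fact
  interpret complex_space scale by unfold_locales
  show ?thesis
    using hilb_eq_rank_series[OF assms(2)] rank_series_eq_tutte[of A] assms(3,4)
    by (simp add: hilb_def)
qed

end
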